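(* Let $(V,E)$ be a finite connected graph, $a_0,a_1\in V$ two distinct vertices, $\omega>0$, $\lambda=i\omega$, and for each edge $xy$ let $R_{xy},L_{xy},D_{xy}\ge 0$ with $R_{xy}^2+L_{xy}^2+D_{xy}^2\ne0$ and $L_{xy}\lambda^2+R_{xy}\lambda+D_{xy}\neq 0$; set $\rho_{xy}=\dfrac{\lambda}{L_{xy}\lambda^2+R_{xy}\lambda+D_{xy}}$ for $xy\in E$ and $\rho_{xy}=0$ otherwise. Consider the Dirichlet problem for $v:V\to\mathbb{C}$: $$\sum_{y\in V}(v(y)-v(x))\rho_{xy}=0\ \text{ for } x\in V\setminus\{a_0,a_1\},\qquad v(a_0)=0,\qquad v(a_1)=1.$$ Then the quantity $\mathcal{P}_{eff}=\sum_{x:x\sim a_0}v(x)\rho_{xa_0}$ (and hence $Z_{eff}=1/\mathcal{P}_{eff}$) is the same for all solutions $v$ of this problem, and for every solution $v$, $$\frac12\sum_{x,y\in V}|v(y)-v(x)|^2\rho_{xy}=\mathcal{P}_{eff}.$$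
   Context: $x\sim a_0$ means $x$ is adjacent to $a_0$. $R_{xy},L_{xy},D_{xy}$ are resistance, inductance and inverse capacitance; $\rho_{xy}$ is the complex admittance; $\mathcal{P}_{eff}$ and $Z_{eff}\in\mathbb{C}\cup\{\infty\}$ are the effective admittance and effective impedance. *)

theory Defs
  imports Complex_Main "Graph_Theory.Graph_Theory"
begin

text \<open>
  An undirected graph is a symmetric digraph whose arcs are pairs of vertices, so an edge \<open>xy\<close>
  is present as both \<open>(x, y)\<close> and \<open>(y, x)\<close>. The functions \<open>R\<close>, \<open>L\<close>, \<open>D\<close> give resistance,
  inductance and inverse capacitance; the predicate below lets each depend only on the
  unordered edge. Their values off the edges are irrelevant.
\<close>

definition edge_weight :: "'a pair_pre_digraph \<Rightarrow> ('a \<Rightarrow> 'a \<Rightarrow> real) \<Rightarrow> bool" where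
  "edge_weight G W \<longleftrightarrow> (\<forall>(x, y) \<in> parcs G. W x y = W y x \<and> W x y \<ge> 0)"

definition admittance ::
  "'a pair_pre_digraph \<Rightarrow> ('a \<Rightarrow> 'a \<Rightarrow> real) \<Rightarrow> ('a \<Rightarrow> 'a \<Rightarrow> real) \<Rightarrow> ('a \<Rightarrow> 'a \<Rightarrow> real) \<Rightarrow>
    complex \<Rightarrow> 'a \<Rightarrow> 'a \<Rightarrow> complex" where
  "admittance G R L D lam x y =
    (if (x, y) \<in> parcs G
     then lam / (complex_of_real (L x y) * lam\<^sup>2 + complex_of_real (R x y) * lam
                 + complex_of_real (D x y))
     else 0)"

text \<open>Only the values of \<open>v\<close> on the vertices of \<open>G\<close> matter here and in what follows.\<close>

definition dirichlet_solution ::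
  "'a pair_pre_digraph \<Rightarrow> ('a \<Rightarrow> 'a \<Rightarrow> complex) \<Rightarrow> 'a \<Rightarrow> 'a \<Rightarrow> ('a \<Rightarrow> complex) \<Rightarrow> bool" where
  "dirichlet_solution G \<rho> a0 a1 v \<longleftrightarrow>
    (\<forall>x \<in> pverts G - {a0, a1}. (\<Sum>y \<in> pverts G. (v y - v x) * \<rho> x y) = 0) \<and>
    v a0 = 0 \<and> v a1 = 1"

text \<open>
  Effective admittance and impedance as computed from one solution \<open>v\<close>; that they do not
  depend on the choice of \<open>v\<close> is a theorem, not part of the definition.
\<close>

definition eff_admittance ::
  "'a pair_pre_digraph \<Rightarrow> ('a \<Rightarrow> 'a \<Rightarrow> complex) \<Rightarrow> 'a \<Rightarrow> ('a \<Rightarrow> complex) \<Rightarrow> complex" where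
  "eff_admittance G \<rho> a0 v = (\<Sum>x \<in> {x \<in> pverts G. (x, a0) \<in> parcs G}. v x * \<rho> x a0)"

text \<open>
  The impedance lives in the complex numbers extended by \<open>\<infinity>\<close>, where \<open>None\<close> stands for
  \<open>\<infinity> = 1/0\<close>. (HOL division would give \<open>1/0 = 0\<close>.)
\<close>

definition eff_impedance ::
  "'a pair_pre_digraph \<Rightarrow> ('a \<Rightarrow> 'a \<Rightarrow> complex) \<Rightarrow> 'a \<Rightarrow> ('a \<Rightarrow> complex) \<Rightarrow> complex option" where
  "eff_impedance G \<rho> a0 v =
    (if eff_admittance G \<rho> a0 v = 0 then None else Some (1 / eff_admittance G \<rho> a0 v))"

end

theory Submission
  imports Defs
begin

text \<open>
  Green's formula with a test function \<open>g\<close> satisfying \<open>g a0 = 0\<close>, \<open>g a1 = 1\<close> turns the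
  (bilinear, hence symmetric) Dirichlet form of a solution \<open>v\<close> and \<open>g\<close> into the effective
  admittance. Taking for \<open>g\<close> another solution gives the independence of the solution by
  symmetry; taking for \<open>g\<close> the complex conjugate of \<open>v\<close> gives the conservation of power.
\<close>

definition laplacian :: "'a set \<Rightarrow> ('a \<Rightarrow> 'a \<Rightarrow> 'b::comm_ring_1) \<Rightarrow> ('a \<Rightarrow> 'b) \<Rightarrow> 'a \<Rightarrow> 'b" where
  "laplacian V \<rho> f x = (\<Sum>y\<in>V. (f y - f x) * \<rho> x y)"

text \<open>Discrete summation by parts: split \<open>g y - g x\<close> and exchange the two
  summation variables in the \<open>g y\<close> part. By symmetry of \<open>\<rho>\<close> the
  difference of \<open>f\<close> changes sign, so both parts contribute equally, whence the factor
  2. No conjugation enters, so the form is symmetric in \<open>f\<close> and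
  \<open>g\<close>.\<close>

lemma green_formula:
  fixes \<rho> :: "'a \<Rightarrow> 'a \<Rightarrow> 'b::comm_ring_1"
  assumes sym: "\<And>x y. x \<in> V \<Longrightarrow> y \<in> V \<Longrightarrow> \<rho> x y = \<rho> y x"
  shows "(\<Sum>x\<in>V. \<Sum>y\<in>V. (f y - f x) * (g y - g x) * \<rho> x y)
           = - 2 * (\<Sum>x\<in>V. g x * laplacian V \<rho> f x)"
proof -
  let ?S = "\<Sum>x\<in>V. \<Sum>y\<in>V. g x * ((f y - f x) * \<rho> x y)"
  have "(\<Sum>x\<in>V. \<Sum>y\<in>V. g y * ((f y - f x) * \<rho> x y))
          = (\<Sum>x\<in>V. \<Sum>y\<in>V. g x * ((f x - f y) * \<rho> y x))"
    by (rule sum.swap)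
  also have "\<dots> = (\<Sum>x\<in>V. \<Sum>y\<in>V. - (g x * ((f y - f x) * \<rho> x y)))"
    by (intro sum.cong refl) (simp add: sym algebra_simps)
  also have "\<dots> = - ?S"
    by (simp add: sum_negf)
  finally have swapped: "(\<Sum>x\<in>V. \<Sum>y\<in>V. g y * ((f y - f x) * \<rho> x y)) = - ?S" .
  have "(\<Sum>x\<in>V. \<Sum>y\<in>V. (f y - f x) * (g y - g x) * \<rho> x y)
          = (\<Sum>x\<in>V. \<Sum>y\<in>V. g y * ((f y - f x) * \<rho> x y) - g x * ((f y - f x) * \<rho> x y))"
    by (intro sum.cong refl) (simp add: algebra_simps)
  also have "\<dots> = - 2 * ?S"
    by (simp add: sum_subtractf swapped)
  finally show ?thesis
    by (simp add: laplacian_def sum_distrib_left)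
qed

text \<open>A constant test function kills every difference \<open>g y - g x\<close> in Green's
  formula. The sort constraint allows the factor 2 to be cancelled. In circuit terms, the net flows
  at all vertices balance.\<close>

lemma sum_laplacian:
  fixes \<rho> :: "'a \<Rightarrow> 'a \<Rightarrow> 'b::{idom, ring_char_0}"
  assumes "\<And>x y. x \<in> V \<Longrightarrow> y \<in> V \<Longrightarrow> \<rho> x y = \<rho> y x"
  shows "(\<Sum>x\<in>V. laplacian V \<rho> f x) = 0"
  using green_formula[of V \<rho> f "\<lambda>_. 1", OF assms] by simp

lemma admittance_sym:
  assumes "pair_pseudo_graph G"
    and "edge_weight G R" and "edge_weight G L" and "edge_weight G D"
  shows "admittance G R L D lam x y = admittance G R L D lam y x"
proof -
  interpret pair_pseudo_graph G by fact
  have arcs: "(x, y) \<in> parcs G \<longleftrightarrow> (y, x) \<in> parcs G"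
    using arcs_symmetric by blast
  show ?thesis
  proof (cases "(x, y) \<in> parcs G")
    case True
    then have "R x y = R y x" "L x y = L y x" "D x y = D y x"
      using assms(2-4) by (auto simp: edge_weight_def)
    then show ?thesis
      by (simp only: admittance_def arcs)
  next
    case False
    then show ?thesis
      using arcs by (simp add: admittance_def)
  qed
qed

text \<open>Non-neighbours of \<open>a0\<close> have weight zero, and \<open>v a0 = 0\<close> makes
  \<open>v x\<close> the potential difference to \<open>a0\<close>. The effective admittance is thus
  the net flow at that terminal.\<close>

lemma eff_admittance_eq_laplacian:
  assumes "finite (pverts G)" and "v a0 = 0"
    and "\<And>x. \<rho> x a0 = \<rho> a0 x"
    and "\<And>x. (x, a0) \<notin> parcs G \<Longrightarrow> \<rho> x a0 = 0"
  shows "eff_admittance G \<rho> a0 v = laplacian (pverts G) \<rho> v a0"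
proof -
  have "eff_admittance G \<rho> a0 v = (\<Sum>x\<in>pverts G. v x * \<rho> x a0)"
    unfolding eff_admittance_def
    by (rule sum.mono_neutral_left) (use assms(1,4) in auto)
  then show ?thesis
    by (simp add: laplacian_def assms(2,3))
qed

text \<open>As \<open>v\<close> is harmonic elsewhere, Green's formula keeps only the two terminals,
  and the values of \<open>g\<close> there select \<open>a1\<close>. The result is independent of
  \<open>g\<close>, which leaves the test function free to choose.\<close>

lemma dirichlet_form_eq_eff_admittance:
  assumes fin: "finite (pverts G)"
    and a: "a0 \<in> pverts G" "a1 \<in> pverts G" "a0 \<noteq> a1"
    and sym: "\<And>x y. \<rho> x y = \<rho> y x"
    and supp: "\<And>x. (x, a0) \<notin> parcs G \<Longrightarrow> \<rho> x a0 = 0"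
    and sol: "dirichlet_solution G \<rho> a0 a1 v"
    and g: "g a0 = 0" "g a1 = 1"
  shows "(\<Sum>x\<in>pverts G. \<Sum>y\<in>pverts G. (v y - v x) * (g y - g x) * \<rho> x y)
           = 2 * eff_admittance G \<rho> a0 v"
proof -
  let ?lap = "laplacian (pverts G) \<rho> v"
  have eff: "eff_admittance G \<rho> a0 v = ?lap a0"
    by (rule eff_admittance_eq_laplacian)
       (use fin sym supp sol in \<open>auto simp: dirichlet_solution_def\<close>)
  have harmonic: "?lap x = 0" if "x \<in> pverts G - {a0, a1}" for x
    using sol that unfolding dirichlet_solution_def laplacian_def by blast
  \<comment> \<open>Kept general in \<open>h\<close>, to be used with the constant 1 and with
    \<open>g\<close>.\<close>
  have boundary: "(\<Sum>x\<in>pverts G. h x * ?lap x) = h a0 * ?lap a0 + h a1 * ?lap a1" for h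
  proof -
    have "(\<Sum>x\<in>pverts G. h x * ?lap x) = (\<Sum>x\<in>{a0, a1}. h x * ?lap x)"
      by (rule sum.mono_neutral_right) (use fin a harmonic in auto)
    then show ?thesis using a by simp
  qed
  \<comment> \<open>The flow at \<open>a1\<close> is thus minus the one at \<open>a0\<close>; this
    sign cancels the one in Green's formula.\<close>
  have "?lap a0 + ?lap a1 = 0"
    using boundary[of "\<lambda>_. 1"] sum_laplacian[of "pverts G" \<rho> v] sym by simp
  then have "?lap a1 = - ?lap a0"
    by (simp add: add_eq_0_iff)
  then show ?thesis
    using green_formula[of "pverts G" \<rho> v g] sym boundary[of g] g eff by simp
qed

theorem theorem2p9:
  fixes G :: "'a pair_pre_digraph"
    and a0 a1 :: 'a
    and \<omega> :: real
    and lam :: complex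
    and R L D :: "'a \<Rightarrow> 'a \<Rightarrow> real"
    and \<rho> :: "'a \<Rightarrow> 'a \<Rightarrow> complex"
  assumes "pair_pseudo_graph G" and "connected G"
    and "a0 \<in> pverts G" and "a1 \<in> pverts G" and "a0 \<noteq> a1"
    and "\<omega> > 0" and "lam = \<i> * complex_of_real \<omega>"
    and "edge_weight G R" and "edge_weight G L" and "edge_weight G D"
    and "\<And>x y. (x, y) \<in> parcs G \<Longrightarrow> (R x y)\<^sup>2 + (L x y)\<^sup>2 + (D x y)\<^sup>2 \<noteq> 0"
    and "\<And>x y. (x, y) \<in> parcs G \<Longrightarrow>
           complex_of_real (L x y) * lam\<^sup>2 + complex_of_real (R x y) * lam
             + complex_of_real (D x y) \<noteq> 0"
    and "\<rho> = admittance G R L D lam"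
  shows "(\<forall>v w. dirichlet_solution G \<rho> a0 a1 v \<and> dirichlet_solution G \<rho> a0 a1 w \<longrightarrow>
            eff_admittance G \<rho> a0 v = eff_admittance G \<rho> a0 w \<and>
            eff_impedance G \<rho> a0 v = eff_impedance G \<rho> a0 w) \<and>
         (\<forall>v. dirichlet_solution G \<rho> a0 a1 v \<longrightarrow>
            (1 / 2) * (\<Sum>x \<in> pverts G. \<Sum>y \<in> pverts G.
                 complex_of_real ((cmod (v y - v x))\<^sup>2) * \<rho> x y)
              = eff_admittance G \<rho> a0 v)"
proof -
  interpret pair_pseudo_graph G by fact
  have sym: "\<rho> x y = \<rho> y x" for x y
    unfolding assms(13) by (rule admittance_sym) fact+
  have supp: "\<rho> x a0 = 0" if "(x, a0) \<notin> parcs G" for x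
    using that by (simp add: assms(13) admittance_def)
  have form: "(\<Sum>x\<in>pverts G. \<Sum>y\<in>pverts G. (v y - v x) * (g y - g x) * \<rho> x y)
                = 2 * eff_admittance G \<rho> a0 v"
    if "dirichlet_solution G \<rho> a0 a1 v" "g a0 = 0" "g a1 = 1" for v g
    by (rule dirichlet_form_eq_eff_admittance[OF pair_finite_verts assms(3-5) sym supp that])
  have unique: "eff_admittance G \<rho> a0 v = eff_admittance G \<rho> a0 w"
    if v: "dirichlet_solution G \<rho> a0 a1 v" and w: "dirichlet_solution G \<rho> a0 a1 w" for v w
  proof -
    \<comment> \<open>Each solution is an admissible test function for the other.\<close>
    have "2 * eff_admittance G \<rho> a0 v = 2 * eff_admittance G \<rho> a0 w"
      using form[OF v, of w] form[OF w, of v] v w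
      by (simp add: dirichlet_solution_def mult.commute)
    then show ?thesis by simp
  qed
  have power: "(1 / 2) * (\<Sum>x \<in> pverts G. \<Sum>y \<in> pverts G.
                 complex_of_real ((cmod (v y - v x))\<^sup>2) * \<rho> x y)
                = eff_admittance G \<rho> a0 v"
    if v: "dirichlet_solution G \<rho> a0 a1 v" for v
    \<comment> \<open>Conjugation fixes the boundary values 0 and 1, and \<open>z * cnj z\<close> is
      the squared modulus. Without \<open>of_real_power\<close> the square stays inside the
      coercion, where \<open>complex_norm_square\<close> matches it.\<close>
    using form[OF v, of "\<lambda>x. cnj (v x)"] v
    by (simp add: dirichlet_solution_def complex_norm_square del: of_real_power)
  have "eff_impedance G \<rho> a0 v = eff_impedance G \<rho> a0 w"
    if "dirichlet_solution G \<rho> a0 a1 v" "dirichlet_solution G \<rho> a0 a1 w" for v w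
    by (simp only: eff_impedance_def unique[OF that])
  with unique power show ?thesis
    by blast
qed

end
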